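(* Suppose that $\theta={\rm cf}(\lambda)<\lambda$ and assume that the stick principle $\mathrm{stick}(\lambda)$ holds, i.e. there is a family $\mathcal{F}\subseteq[\lambda^+]^{\lambda}$ with $|\mathcal{F}|=\lambda^+$ such that every $y\in[\lambda^+]^{\lambda^+}$ contains some $x\in\mathcal{F}$ as a subset. Then $\lambda^+\nrightarrow(\lambda^+,(3)_{{\rm cf}(\lambda)})^2$.
   Context: For cardinals $\kappa\leq\lambda$, $\mathrm{stick}(\kappa,\lambda)=\min\{|\mathcal{F}| : \mathcal{F}\subseteq[\lambda]^\kappa \text{ and } \forall y\in[\lambda]^\lambda\,\exists x\in\mathcal{F},\ x\subseteq y\}$, and $\mathrm{stick}(\lambda)$ abbreviates the statement $\mathrm{stick}(\lambda,\lambda^+)=\lambda^+$ (a stick sequence $(T_\eta\mid\eta\in\lambda^+)$ with $T_\eta\in[\lambda^+]^\lambda$ exists). The relation $\lambda^+\nrightarrow(\lambda^+,(3)_\theta)^2$ means there is a coloring $c:[\lambda^+]^2\to\theta$ with no $A\in[\lambda^+]^{\lambda^+}$ such that $c''[A]^2=\{0\}$ and no $B\in[\lambda^+]^3$ and $\gamma\in(0,\theta)$ with $c''[B]^2=\{\gamma\}$. *)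

theory Defs
  imports Main "HOL-Library.Ramsey"
begin

unbundle cardinal_syntax

text \<open>
  Cardinals are well-order relations satisfying \<^const>\<open>Card_order\<close>, considered up to \<open>=o\<close>.
  The elements (ordinals) below the cardinal \<open>\<kappa>\<close> form \<^term>\<open>Field \<kappa>\<close>, and \<open>lam\<^sup>+\<close> is
  \<^term>\<open>cardSuc lam\<close>.
\<close>

definition subsets_of_card :: "'a set \<Rightarrow> 'b rel \<Rightarrow> 'a set set"
  where "subsets_of_card A \<kappa> = {X. X \<subseteq> A \<and> |X| =o \<kappa>}"

text \<open>
  \<^const>\<open>cofinal\<close> asks for elements strictly above each given one.  For infinite cardinals, which
  have no greatest element, this is the same as being unbounded.
\<close>

definition least_cofinal :: "'a rel \<Rightarrow> 'a set \<Rightarrow> bool"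
  where "least_cofinal r A \<longleftrightarrow> A \<subseteq> Field r \<and> cofinal A r \<and>
    (\<forall>B. B \<subseteq> Field r \<and> cofinal B r \<longrightarrow> |A| \<le>o |B| )"

definition cofinality :: "'a rel \<Rightarrow> 'a rel"
  where "cofinality r = |SOME A. least_cofinal r A|"

lemma least_cofinal_exists:
  assumes "Card_order r" "cinfinite r"
  shows "\<exists>A. least_cofinal r A"
proof -
  let ?R = "{|A| | A. A \<subseteq> Field r \<and> cofinal A r}"
  have "cofinal (Field r) r"
    unfolding cofinal_def using assms infinite_Card_order_limit cinfinite_def
    by (metis FieldI2)
  then have "?R \<noteq> {}" by blast
  moreover have "\<forall>r\<in>?R. Card_order r" using card_of_Card_order by blast
  ultimately obtain k where "k \<in> ?R" "\<forall>k'\<in>?R. k \<le>o k'"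
    using exists_minim_Card_order[of ?R] by blast
  then show ?thesis unfolding least_cofinal_def by blast
qed

definition stick_family :: "'b rel \<Rightarrow> 'a rel \<Rightarrow> 'a set set \<Rightarrow> bool"
  where "stick_family \<kappa> \<mu> F \<longleftrightarrow> F \<subseteq> subsets_of_card (Field \<mu>) \<kappa> \<and>
    (\<forall>y \<in> subsets_of_card (Field \<mu>) \<mu>. \<exists>x \<in> F. x \<subseteq> y)"

definition stick :: "'a rel \<Rightarrow> bool"
  where "stick lam \<longleftrightarrow> (\<exists>F. stick_family lam (cardSuc lam) F \<and> |F| =o cardSuc lam)"

text \<open>
  The bound below shows that a family as in \<^const>\<open>stick\<close> has the least possible cardinality, so
  that \<^term>\<open>stick lam\<close> says that the minimal size of a stick family is \<open>lam\<^sup>+\<close>.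
\<close>

lemma stick_family_ge:
  assumes "Card_order lam" "cinfinite lam" "stick_family lam (cardSuc lam) F"
  shows "cardSuc lam \<le>o |F|"
proof (rule ccontr)
  let ?S = "Field (cardSuc lam)"
  have co: "Card_order (cardSuc lam)" using assms(1) by (rule cardSuc_Card_order)
  have infS: "infinite ?S" and infl: "infinite (Field lam)"
    using assms(1,2) cardSuc_finite cinfinite_def by blast+
  assume "\<not> cardSuc lam \<le>o |F|"
  then have "|F| <o cardSuc lam"
    using ordLess_or_ordLeq[OF card_of_Well_order card_order_on_well_order_on[OF co]] by blast
  then have F: "|F| \<le>o lam"
    using cardSuc_ordLeq_ordLess[OF assms(1) card_of_Card_order] by blast
  have "|\<Union>x\<in>F. x| \<le>o lam"
    by (rule card_of_UNION_ordLeq_infinite_Field[OF infl assms(1) F])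
      (use assms(3) in \<open>auto simp: stick_family_def subsets_of_card_def intro: ordIso_imp_ordLeq\<close>)
  then have "|\<Union>F| \<le>o lam" by simp
  then have "|\<Union>F| <o cardSuc lam"
    using cardSuc_ordLeq_ordLess[OF assms(1) card_of_Card_order] by blast
  then have "|\<Union>F| <o |?S|"
    using card_of_Field_ordIso[OF co] ordIso_symmetric ordLess_ordIso_trans by blast
  then have "|?S - \<Union>F| =o |?S|"
  proof -
    have "\<not> |?S - \<Union>F| <o |?S|"
    proof
      assume "|?S - \<Union>F| <o |?S|"
      then have "|(?S - \<Union>F) \<union> \<Union>F| <o |?S|"
        using card_of_Un_ordLess_infinite[OF infS] \<open>|\<Union>F| <o |?S|\<close> by blast
      moreover have "|?S| \<le>o |(?S - \<Union>F) \<union> \<Union>F|"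
        by (rule card_of_mono1) blast
      ultimately show False
        using not_ordLess_ordLeq by blast
    qed
    moreover have "|?S - \<Union>F| \<le>o |?S|"
      by (rule card_of_mono1) blast
    ultimately show ?thesis
      using ordLeq_iff_ordLess_or_ordIso by blast
  qed
  then have "?S - \<Union>F \<in> subsets_of_card ?S (cardSuc lam)"
    using card_of_Field_ordIso[OF co] ordIso_transitive unfolding subsets_of_card_def by blast
  then obtain x where x: "x \<in> F" "x \<subseteq> ?S - \<Union>F"
    using assms(3) unfolding stick_family_def by blast
  then have "x = {}" by blast
  moreover have "|x| =o lam"
    using assms(3) x(1) by (auto simp: stick_family_def subsets_of_card_def)
  then have "|x| =o |Field lam|"
    using card_of_Field_ordIso[OF assms(1)] ordIso_symmetric ordIso_transitive by blast
  ultimately show False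
    using infl card_of_ordIso_finite by blast
qed

text \<open>
  The negative relation \<open>\<kappa> \<nrightarrow> (\<mu>, (m)\<^sub>\<theta>)\<^sup>2\<close>.  Unordered pairs are two-element
  sets, the colours are the elements of \<^term>\<open>Field \<theta>\<close>, and the colour \<open>0\<close> is the least
  element of \<open>\<theta>\<close>.
\<close>

definition least_elem :: "'c rel \<Rightarrow> 'c"
  where "least_elem \<theta> = wo_rel.minim \<theta> (Field \<theta>)"

definition negative_partition :: "'a rel \<Rightarrow> 'b rel \<Rightarrow> nat \<Rightarrow> 'c rel \<Rightarrow> bool"
  where "negative_partition \<kappa> \<mu> m \<theta> \<longleftrightarrow>
    (\<exists>c \<in> nsets (Field \<kappa>) 2 \<rightarrow> Field \<theta>.
       \<not> (\<exists>A \<in> subsets_of_card (Field \<kappa>) \<mu>. c ` nsets A 2 = {least_elem \<theta>}) \<and>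
       \<not> (\<exists>B \<in> nsets (Field \<kappa>) m. \<exists>\<gamma> \<in> Field \<theta> - {least_elem \<theta>}. c ` nsets B 2 = {\<gamma>}))"

end

theory Submission
  imports Defs
begin

text \<open>
  The colour of a pair is chosen by recursion on its larger element \<open>\<alpha> < lam\<^sup>+\<close>.  Split the
  indices \<open>\<eta> < \<alpha>\<close> of the stick sequence \<open>T\<close> into \<open>\<theta>\<close> many pieces \<open>I\<^sub>i\<close> of size
  \<open>\<kappa>\<^sub>i < lam\<close>, one for each nonzero colour \<open>i\<close>.  In colour \<open>i\<close>, join \<open>\<alpha>\<close> to a set of
  at most \<open>\<kappa>\<^sub>i\<close> smaller ordinals that meets every \<open>T\<^sub>\<eta> \<subseteq> \<alpha>\<close> with \<open>\<eta> \<in> I\<^sub>i\<close> and contains no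
  pair of colour \<open>i\<close>: then no triangle is homogeneous in a nonzero colour, and a set of size
  \<open>lam\<^sup>+\<close>, which contains some \<open>T\<^sub>\<eta>\<close>, is not homogeneous in colour \<open>0\<close>.  Such a set is a free
  transversal for the set mapping sending \<open>\<beta>\<close> to its earlier neighbours of colour \<open>i\<close>, whose
  values have size at most \<open>\<kappa>\<^sub>i\<close>.  It exists because \<open>|T\<^sub>\<eta>| = lam > \<kappa>\<^sub>i\<^sup>+\<close>, \<open>lam\<close> being singular
  and hence a limit cardinal.
\<close>

section \<open>Maximal families, chosen disjointly by recursion\<close>

text \<open>Zorn's lemma: any two points of the union of a chain already lie in one member of the
  chain, so \<open>pairwise Q\<close> passes to the union.\<close>

lemma maximal_pairwise_exists:
  "\<exists>m \<subseteq> A. pairwise Q m \<and> (\<forall>a \<in> A - m. \<not> pairwise Q (insert a m))"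
proof -
  let ?S = "{m. m \<subseteq> A \<and> pairwise Q m}"
  have "\<Union>C \<in> ?S" if C: "subset.chain ?S C" for C
  proof -
    have "Q x y" if "x \<in> X" "X \<in> C" "y \<in> Y" "Y \<in> C" "x \<noteq> y" for x y X Y
    proof -
      have "X \<subseteq> Y \<or> Y \<subseteq> X"
        using C that unfolding subset_chain_def by blast
      moreover have "pairwise Q X" "pairwise Q Y"
        using C that unfolding subset_chain_def by blast+
      ultimately show ?thesis
        using that unfolding pairwise_def by blast
    qed
    then have "pairwise Q (\<Union>C)"
      unfolding pairwise_def by blast
    moreover have "\<Union>C \<subseteq> A"
      using C unfolding subset_chain_def by blast
    ultimately show ?thesis by blast
  qed
  from subset_Zorn'[OF this] obtain m where
    m: "m \<in> ?S" "\<forall>X\<in>?S. m \<subseteq> X \<longrightarrow> X = m" by blast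
  have "\<not> pairwise Q (insert a m)" if a: "a \<in> A - m" for a
  proof
    assume "pairwise Q (insert a m)"
    then have "insert a m \<in> ?S" using m(1) a by blast
    then show False using m(2) a by blast
  qed
  then show ?thesis using m(1) by blast
qed

lemma card_order_wf_strict:
  assumes "Card_order r"
  shows "wf (r - Id)"
  using assms unfolding card_order_on_def well_order_on_def by blast

lemma underS_trichotomy:
  assumes "Card_order r" "a \<in> Field r" "b \<in> Field r" "a \<noteq> b"
  shows "a \<in> underS r b \<or> b \<in> underS r a"
proof -
  have "total_on (Field r) r"
    using assms(1) unfolding card_order_on_def well_order_on_def linear_order_on_def by blast
  then show ?thesis
    using assms(2-4) unfolding total_on_def underS_def by blast
qed

lemma disjoint_maximal_families:
  assumes "Card_order r"
  shows "\<exists>F :: 'k \<Rightarrow> ('i \<times> 'x) set. \<forall>\<xi>.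
    F \<xi> \<subseteq> (SIGMA e:I. T e - (\<Union>\<zeta>\<in>underS (r :: 'k rel) \<xi>. snd ` F \<zeta>)) \<and> pairwise Q (F \<xi>) \<and>
    (\<forall>a \<in> (SIGMA e:I. T e - (\<Union>\<zeta>\<in>underS r \<xi>. snd ` F \<zeta>)) - F \<xi>. \<not> pairwise Q (insert a (F \<xi>)))"
proof (rule dependent_wf_choice[OF card_order_wf_strict[OF assms]])
  fix f g :: "'k \<Rightarrow> ('i \<times> 'x) set" and \<xi> m
  assume "\<And>\<zeta>. (\<zeta>, \<xi>) \<in> r - Id \<Longrightarrow> f \<zeta> = g \<zeta>"
  then have eq: "(\<Union>\<zeta>\<in>underS r \<xi>. snd ` f \<zeta>) = (\<Union>\<zeta>\<in>underS r \<xi>. snd ` g \<zeta>)"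
    unfolding underS_def by auto
  show "(m \<subseteq> (SIGMA e:I. T e - (\<Union>\<zeta>\<in>underS r \<xi>. snd ` f \<zeta>)) \<and> pairwise Q m \<and>
    (\<forall>a \<in> (SIGMA e:I. T e - (\<Union>\<zeta>\<in>underS r \<xi>. snd ` f \<zeta>)) - m. \<not> pairwise Q (insert a m)))
    = (m \<subseteq> (SIGMA e:I. T e - (\<Union>\<zeta>\<in>underS r \<xi>. snd ` g \<zeta>)) \<and> pairwise Q m \<and>
    (\<forall>a \<in> (SIGMA e:I. T e - (\<Union>\<zeta>\<in>underS r \<xi>. snd ` g \<zeta>)) - m. \<not> pairwise Q (insert a m)))"
    unfolding eq ..
qed (rule maximal_pairwise_exists)

section \<open>Free transversals of set mappings\<close>

lemma card_of_image_ordLeq: "|A| \<le>o r \<Longrightarrow> |f ` A| \<le>o r"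
  by (rule ordLeq_transitive[OF card_of_image])

lemma card_of_ordLess_not_subset:
  assumes "|B| <o |A|"
  obtains a where "a \<in> A" "a \<notin> B"
proof -
  have "\<not> A \<subseteq> B"
    using card_of_mono1[of A B] not_ordLess_ordLeq[OF assms] by blast
  then show ?thesis using that by blast
qed

text \<open>
  Build \<open>k\<^sup>+\<close> many pairwise disjoint maximal partial free transversals.  If none is total, then
  more than \<open>k\<close> of them miss the same \<open>T e\<close>.  A point \<open>y \<in> T e\<close> outside all of them
  and outside all their \<open>g\<close>-values exists since \<open>|T e| > k\<^sup>+\<close>; by maximality \<open>g y\<close> meets each of
  those missing \<open>T e\<close>, which contradicts \<open>|g y| \<le> k\<close>.
\<close>

lemma free_transversal:
  fixes k :: "'k rel" and I :: "'i set" and T :: "'i \<Rightarrow> 'x set" and g :: "'x \<Rightarrow> 'x set"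
  assumes k: "Card_order k" "infinite (Field k)"
    and I: "|I| \<le>o k"
    and T: "\<And>e. e \<in> I \<Longrightarrow> cardSuc k <o |T e|"
    and g: "\<And>e x. e \<in> I \<Longrightarrow> x \<in> T e \<Longrightarrow> |g x| \<le>o k"
  shows "\<exists>S. S \<subseteq> (\<Union>e\<in>I. T e) \<and> |S| \<le>o k \<and> (\<forall>e\<in>I. T e \<inter> S \<noteq> {}) \<and>
    (\<forall>x\<in>S. \<forall>y\<in>S. x \<noteq> y \<longrightarrow> y \<notin> g x)"
proof -
  let ?r = "cardSuc k"
  have r: "Card_order ?r" "infinite (Field ?r)"
    using k cardSuc_Card_order cardSuc_finite by blast+
  have kr: "k \<le>o ?r" using k(1) by (rule cardSuc_ordLeq)
  \<comment> \<open>A \<open>Q\<close>-pairwise family is a partial choice function on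
    \<open>I\<close> whose values are free for \<open>g\<close>. Distinct indices may share a value.
    \<open>pairwise\<close> tests both orders, so freeness holds in both directions.\<close>
  define Q where "Q a b \<longleftrightarrow> fst a \<noteq> fst b \<and>
    (snd a \<noteq> snd b \<longrightarrow> snd b \<notin> g (snd a))" for a b :: "'i \<times> 'x"
  obtain F where F: "\<And>\<xi>. F \<xi> \<subseteq> (SIGMA e:I. T e - (\<Union>\<zeta>\<in>underS ?r \<xi>. snd ` F \<zeta>))"
    and FQ: "\<And>\<xi>. pairwise Q (F \<xi>)"
    and Fmax: "\<And>\<xi> a. a \<in> (SIGMA e:I. T e - (\<Union>\<zeta>\<in>underS ?r \<xi>. snd ` F \<zeta>)) - F \<xi> \<Longrightarrow>
       \<not> pairwise Q (insert a (F \<xi>))"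
    using disjoint_maximal_families[OF r(1), of I T Q] by metis
  have Fk: "|F \<xi>| \<le>o k" for \<xi>
  proof -
    have "inj_on fst (F \<xi>)"
      using FQ[of \<xi>] unfolding pairwise_def Q_def inj_on_def by blast
    moreover have "fst ` F \<xi> \<subseteq> I" using F[of \<xi>] by auto
    ultimately have "|F \<xi>| \<le>o |I|" using card_of_ordLeq by blast
    then show ?thesis using I ordLeq_transitive by blast
  qed
  show ?thesis
  proof (cases "\<exists>\<xi>. I \<subseteq> fst ` F \<xi>")
    case True
    then obtain \<xi> where \<xi>: "I \<subseteq> fst ` F \<xi>" by blast
    have "|snd ` F \<xi>| \<le>o k" using Fk by (rule card_of_image_ordLeq)
    moreover have "T e \<inter> snd ` F \<xi> \<noteq> {}" if "e \<in> I" for e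
    proof -
      obtain x where "(e, x) \<in> F \<xi>" using \<xi> \<open>e \<in> I\<close> by force
      then show ?thesis using F[of \<xi>] by force
    qed
    moreover have "y \<notin> g x" if "x \<in> snd ` F \<xi>" "y \<in> snd ` F \<xi>" "x \<noteq> y" for x y
      using FQ[of \<xi>] that unfolding pairwise_def Q_def by fastforce
    moreover have "snd ` F \<xi> \<subseteq> (\<Union>e\<in>I. T e)" using F[of \<xi>] by force
    ultimately show ?thesis by blast
  next
    case False
    then have "\<forall>\<xi>. \<exists>e. e \<in> I \<and> e \<notin> fst ` F \<xi>" by blast
    then obtain miss where miss: "\<And>\<xi>. miss \<xi> \<in> I" "\<And>\<xi>. miss \<xi> \<notin> fst ` F \<xi>" by metis
    \<comment> \<open>Pigeonhole: otherwise \<open>Field ?r\<close> would be a union of at most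
      \<open>k\<close> sets of size at most \<open>k\<close>.\<close>
    have "\<exists>e\<in>I. \<not> |{\<xi> \<in> Field ?r. miss \<xi> = e}| \<le>o k"
    proof (rule ccontr)
      assume "\<not> ?thesis"
      then have "\<forall>e\<in>I. |{\<xi> \<in> Field ?r. miss \<xi> = e}| \<le>o k" by blast
      from card_of_UNION_ordLeq_infinite_Field[OF k(2,1) I this]
      have "|\<Union>e\<in>I. {\<xi> \<in> Field ?r. miss \<xi> = e}| \<le>o k" .
      moreover have "(\<Union>e\<in>I. {\<xi> \<in> Field ?r. miss \<xi> = e}) = Field ?r"
        using miss(1) by blast
      ultimately have "|Field ?r| \<le>o k" by simp
      then have "|Field ?r| <o ?r"
        using cardSuc_ordLeq_ordLess[OF k(1) card_of_Card_order] by blast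
      then show False
        using card_of_Field_ordIso[OF r(1)] not_ordLess_ordIso by blast
    qed
    then obtain e where e: "e \<in> I" and big: "\<not> |{\<xi> \<in> Field ?r. miss \<xi> = e}| \<le>o k" by blast
    define X where "X = {\<xi> \<in> Field ?r. miss \<xi> = e}"
    define U where "U = (\<Union>\<xi>\<in>Field ?r. snd ` F \<xi>)"
    have FR: "|Field ?r| \<le>o ?r"
      using card_of_Field_ordIso[OF r(1)] ordIso_imp_ordLeq by blast
    have U: "|U| \<le>o ?r"
      unfolding U_def
      by (rule card_of_UNION_ordLeq_infinite_Field[OF r(2,1) FR])
        (use Fk card_of_image_ordLeq kr ordLeq_transitive in blast)
    have gU: "|\<Union>x\<in>U. g x| \<le>o ?r"
    proof (rule card_of_UNION_ordLeq_infinite_Field[OF r(2,1) U], rule)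
      fix x assume "x \<in> U"
      then obtain e' where "e' \<in> I" "x \<in> T e'" using F unfolding U_def by fastforce
      then show "|g x| \<le>o ?r" using g kr ordLeq_transitive by blast
    qed
    have "|U \<union> (\<Union>x\<in>U. g x)| <o |T e|"
      using card_of_Un_ordLeq_infinite_Field[OF r(2) U gU r(1)] T[OF e] ordLeq_ordLess_trans
      by blast
    then obtain y where y: "y \<in> T e" "y \<notin> U \<union> (\<Union>x\<in>U. g x)"
      by (rule card_of_ordLess_not_subset)
    have "\<exists>x \<in> snd ` F \<xi>. x \<in> g y" if \<xi>: "\<xi> \<in> X" for \<xi>
    proof -
      have dom: "e \<notin> fst ` F \<xi>" and fld: "\<xi> \<in> Field ?r" using \<xi> miss(2) unfolding X_def by blast+
      have "underS ?r \<xi> \<subseteq> Field ?r" unfolding underS_def Field_def by blast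
      then have "y \<notin> (\<Union>\<zeta>\<in>underS ?r \<xi>. snd ` F \<zeta>)" using y(2) unfolding U_def by blast
      moreover have "(e, y) \<notin> F \<xi>" using dom by force
      ultimately have "\<not> pairwise Q (insert (e, y) (F \<xi>))"
        using Fmax e y(1) by blast
      \<comment> \<open>Of the ways for \<open>Q\<close> to fail, equal indices are excluded as
        \<open>e\<close> is missed, and \<open>y \<in> g (snd b)\<close> is excluded by the choice
        of \<open>y\<close>. Only \<open>snd b \<in> g y\<close> remains.\<close>
      then obtain b where b: "b \<in> F \<xi>" "\<not> Q (e, y) b \<or> \<not> Q b (e, y)"
        using FQ[of \<xi>] unfolding pairwise_insert by blast
      have "fst b \<noteq> e" using b(1) dom by blast
      moreover have "snd b \<in> U" using b(1) fld unfolding U_def by blast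
      ultimately have "snd b \<in> g y" using b(2) y(2) unfolding Q_def by auto
      then show ?thesis using b(1) by blast
    qed
    then obtain p where p: "\<And>\<xi>. \<xi> \<in> X \<Longrightarrow> p \<xi> \<in> snd ` F \<xi> \<and> p \<xi> \<in> g y" by metis
    have disj: "snd ` F \<xi> \<inter> snd ` F \<zeta> = {}" if "\<zeta> \<in> underS ?r \<xi>" for \<xi> \<zeta>
      using F[of \<xi>] that by force
    have "inj_on p X"
    proof (rule inj_onI, rule ccontr)
      fix \<xi> \<zeta> assume *: "\<xi> \<in> X" "\<zeta> \<in> X" "p \<xi> = p \<zeta>" "\<xi> \<noteq> \<zeta>"
      then have "\<xi> \<in> underS ?r \<zeta> \<or> \<zeta> \<in> underS ?r \<xi>"
        using underS_trichotomy[OF r(1)] unfolding X_def by blast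
      then have "snd ` F \<xi> \<inter> snd ` F \<zeta> = {}" using disj by blast
      then show False using p *(1-3) by (metis disjoint_iff)
    qed
    then have "|X| \<le>o |g y|" using p card_of_ordLeq[of X "g y"] by blast
    then have "|X| \<le>o k" using g[OF e y(1)] ordLeq_transitive by blast
    then show ?thesis using big unfolding X_def by blast
  qed
qed

section \<open>The colouring, by recursion on the larger element\<close>

text \<open>Row \<open>\<alpha>\<close> is built from the rows below it by one application of
  \<open>free_transversal\<close> per colour. The bound \<open>k i\<close> on the colour classes is
  part of the recursion because later rows need it as the bound on their set mapping.\<close>

lemma colouring_exists:
  fixes lam :: "'l rel" and mu :: "'m rel" and k :: "'c \<Rightarrow> 'k rel" and T :: "'m \<Rightarrow> 'm set"
  assumes mu: "Card_order mu" "\<And>\<alpha>. |underS mu \<alpha>| \<le>o |Field lam|"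
    and k: "\<And>i. i \<in> J \<Longrightarrow> Card_order (k i)" "\<And>i. i \<in> J \<Longrightarrow> infinite (Field (k i))"
      "\<And>i. i \<in> J \<Longrightarrow> cardSuc (k i) <o lam"
    and L: "\<And>i. i \<in> J \<Longrightarrow> |L i| \<le>o k i" "Field lam \<subseteq> (\<Union>i\<in>J. L i)"
    and T: "\<And>\<eta>. \<eta> \<in> Field mu \<Longrightarrow> |T \<eta>| =o lam"
    and z: "z \<notin> J"
  shows "\<exists>f. \<forall>\<alpha>. (\<forall>\<beta>. f \<alpha> \<beta> \<in> insert z J) \<and>
    (\<forall>i\<in>J. |{\<beta> \<in> underS mu \<alpha>. f \<alpha> \<beta> = i}| \<le>o k i \<and>
      (\<forall>\<beta> \<in> underS mu \<alpha>. \<forall>\<gamma> \<in> underS mu \<alpha>. \<gamma> \<in> underS mu \<beta> \<longrightarrow> f \<alpha> \<beta> = i \<longrightarrow> f \<alpha> \<gamma> = i \<longrightarrow> f \<beta> \<gamma> \<noteq> i)) \<and>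
    (\<forall>\<eta> \<in> underS mu \<alpha>. T \<eta> \<subseteq> underS mu \<alpha> \<longrightarrow> (\<exists>\<beta> \<in> T \<eta>. f \<alpha> \<beta> \<noteq> z))"
proof (rule dependent_wf_choice[OF card_order_wf_strict[OF mu(1)]], goal_cases)
  case (1 f g \<alpha> c)
  then have "f \<beta> = g \<beta>" if "\<beta> \<in> underS mu \<alpha>" for \<beta> using that unfolding underS_def by blast
  \<comment> \<open>The condition on row \<open>\<alpha>\<close> consults other rows
    \<open>f \<beta>\<close> only for \<open>\<beta>\<close> below \<open>\<alpha>\<close>.\<close>
  then show ?case by (simp cong: ball_cong)
next
  case (2 \<alpha> f)
  define N where "N i x = {\<beta> \<in> underS mu x. f x \<beta> = i}" for i x
  have N: "|N i x| \<le>o k i" if "i \<in> J" "x \<in> underS mu \<alpha>" for i x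
    using 2[of x] that unfolding underS_def N_def by auto
  \<comment> \<open>The injection \<open>e\<close> pulls the cover \<open>L\<close> of
    \<open>Field lam\<close> back to the indices below \<open>\<alpha>\<close>, which splits them
    into pieces \<open>I i\<close> of size at most \<open>k i\<close>.\<close>
  obtain e where e: "inj_on e (underS mu \<alpha>)" "e ` underS mu \<alpha> \<subseteq> Field lam"
    using mu(2)[of \<alpha>] card_of_ordLeq by metis
  define I where "I i = {\<eta> \<in> underS mu \<alpha>. T \<eta> \<subseteq> underS mu \<alpha> \<and> e \<eta> \<in> L i}" for i
  have "\<exists>S. S \<subseteq> (\<Union>\<eta>\<in>I i. T \<eta>) \<and> |S| \<le>o k i \<and> (\<forall>\<eta>\<in>I i. T \<eta> \<inter> S \<noteq> {}) \<and>
    (\<forall>x\<in>S. \<forall>y\<in>S. x \<noteq> y \<longrightarrow> y \<notin> N i x)" if i: "i \<in> J" for i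
  proof (rule free_transversal[OF k(1)[OF i] k(2)[OF i]])
    have "inj_on e (I i)" "e ` I i \<subseteq> L i"
      using e(1) unfolding I_def by (auto intro: inj_on_subset)
    then have "|I i| \<le>o |L i|" using card_of_ordLeq by blast
    then show "|I i| \<le>o k i" using L(1)[OF i] ordLeq_transitive by blast
    fix \<eta> assume \<eta>: "\<eta> \<in> I i"
    then have "\<eta> \<in> Field mu" unfolding I_def by (blast dest: underS_Field)
    then show "cardSuc (k i) <o |T \<eta>|"
      using k(3)[OF i] T ordIso_symmetric ordLess_ordIso_trans by blast
    show "|N i x| \<le>o k i" if "x \<in> T \<eta>" for x
      using \<eta> that N[OF i] unfolding I_def by blast
  qed
  then obtain S where S: "\<And>i. i \<in> J \<Longrightarrow> |S i| \<le>o k i"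
    "\<And>i \<eta>. i \<in> J \<Longrightarrow> \<eta> \<in> I i \<Longrightarrow> T \<eta> \<inter> S i \<noteq> {}"
    "\<And>i x y. i \<in> J \<Longrightarrow> x \<in> S i \<Longrightarrow> y \<in> S i \<Longrightarrow> x \<noteq> y \<Longrightarrow> y \<notin> N i x"
    by metis
  \<comment> \<open>The sets \<open>S i\<close> may overlap, and any choice of colour will do: class
    \<open>i\<close> stays inside \<open>S i\<close>, hence small and free, and every point of every
    \<open>S i\<close> still receives a colour other than \<open>z\<close>.\<close>
  define c where "c \<beta> = (if \<exists>i\<in>J. \<beta> \<in> S i then SOME i. i \<in> J \<and> \<beta> \<in> S i else z)" for \<beta>
  have c: "c \<beta> \<in> J \<and> \<beta> \<in> S (c \<beta>)" if "\<exists>i\<in>J. \<beta> \<in> S i" for \<beta>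
    using that someI_ex[of "\<lambda>i. i \<in> J \<and> \<beta> \<in> S i"] unfolding c_def by auto
  have c1: "c \<beta> \<in> insert z J" for \<beta>
    using c[of \<beta>] unfolding c_def by auto
  have c2: "\<beta> \<in> S i" if "c \<beta> = i" "i \<in> J" for \<beta> i
  proof -
    have "c \<beta> \<noteq> z" using that z by blast
    then have "\<exists>i\<in>J. \<beta> \<in> S i" unfolding c_def by presburger
    then show ?thesis using c[of \<beta>] that(1) by blast
  qed
  show ?case
  proof (intro exI[of _ c] conjI allI ballI impI)
    show "c \<beta> \<in> insert z J" for \<beta> by (rule c1)
    show "|{\<beta> \<in> underS mu \<alpha>. c \<beta> = i}| \<le>o k i" if i: "i \<in> J" for i
    proof -
      have "|{\<beta> \<in> underS mu \<alpha>. c \<beta> = i}| \<le>o |S i|"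
        by (rule card_of_mono1) (use c2 i in blast)
      then show ?thesis using S(1)[OF i] ordLeq_transitive by blast
    qed
    show "f \<beta> \<gamma> \<noteq> i" if "i \<in> J" "\<gamma> \<in> underS mu \<beta>" "c \<beta> = i" "c \<gamma> = i" for i \<beta> \<gamma>
    proof -
      have "\<beta> \<noteq> \<gamma>" using that(2) unfolding underS_def by blast
      then have "\<gamma> \<notin> N i \<beta>" using S(3) c2 that by blast
      then show ?thesis using that(2) unfolding N_def by blast
    qed
    show "\<exists>\<beta>\<in>T \<eta>. c \<beta> \<noteq> z" if \<eta>: "\<eta> \<in> underS mu \<alpha>" "T \<eta> \<subseteq> underS mu \<alpha>" for \<eta>
    proof -
      obtain i where i: "i \<in> J" "e \<eta> \<in> L i" using e(2) L(2) \<eta>(1) by blast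
      then have "\<eta> \<in> I i" using \<eta> unfolding I_def by blast
      then obtain \<beta> where "\<beta> \<in> T \<eta>" "\<beta> \<in> S i" using S(2) i(1) by blast
      then show ?thesis using c[of \<beta>] i(1) z by metis
    qed
  qed
qed

section \<open>Cofinal sets in singular and regular cardinals\<close>

text \<open>A nonempty finite set has a greatest element, while \<open>cofinal\<close> demands a
  member strictly above it.\<close>

lemma cofinal_infinite:
  assumes "Card_order r" "infinite (Field r)" "C \<subseteq> Field r" "cofinal C r"
  shows "infinite C"
proof
  assume "finite C"
  have wo: "wo_rel r" using assms(1) unfolding card_order_on_def wo_rel_def by blast
  have "C \<noteq> {}" using assms(2,4) unfolding cofinal_def by fastforce
  have "\<exists>m\<in>C. \<forall>a\<in>C. (a, m) \<in> r"
    using \<open>finite C\<close> \<open>C \<noteq> {}\<close> assms(3)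
  proof (induction C rule: finite_ne_induct)
    case (singleton x)
    then show ?case using wo_rel.REFL[OF wo] unfolding refl_on_def by blast
  next
    case (insert x C)
    then obtain m where m: "m \<in> C" "\<forall>a\<in>C. (a, m) \<in> r" by blast
    have "(x, m) \<in> r \<or> (m, x) \<in> r" "(x, x) \<in> r"
      using wo_rel.TOTALS[OF wo] insert.prems m(1) by blast+
    then show ?case
    proof (elim disjE)
      assume "(x, m) \<in> r"
      then have "\<forall>a\<in>insert x C. (a, m) \<in> r" using m(2) by blast
      then show ?thesis using m(1) by blast
    next
      assume "(m, x) \<in> r"
      then have "\<forall>a\<in>insert x C. (a, x) \<in> r"
        using m(2) \<open>(x, x) \<in> r\<close> wo_rel.TRANS[OF wo] unfolding trans_def by blast
      then show ?thesis by blast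
    qed
  qed
  then obtain m where m: "m \<in> C" "\<forall>a\<in>C. (a, m) \<in> r" by blast
  then obtain b where "b \<in> C" "m \<noteq> b" "(m, b) \<in> r"
    using assms(3,4) unfolding cofinal_def by blast
  then show False using m wo_rel.ANTISYM[OF wo] unfolding antisym_def by blast
qed

text \<open>Infinite successor cardinals are regular, so equality with \<open>r\<close> would
  contradict the small cofinal set \<open>C\<close>.\<close>

lemma singular_cardSuc_ordLess:
  assumes "Card_order r" "C \<subseteq> Field r" "cofinal C r" "|C| <o r"
    and "Card_order k" "infinite (Field k)" "k <o r"
  shows "cardSuc k <o r"
proof -
  have le: "cardSuc k \<le>o r"
    using cardSuc_ordLess_ordLeq[OF assms(5,1)] assms(7) by blast
  have "\<not> cardSuc k =o r"
  proof
    assume "cardSuc k =o r"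
    moreover have "Cinfinite (cardSuc k)"
      using assms(5,6) Cinfinite_cardSuc unfolding cinfinite_def by blast
    moreover have "regularCard (cardSuc k)"
      using assms(5,6) by (simp add: infinite_cardSuc_regularCard)
    ultimately have "regularCard r" by (rule regularCard_ordIso)
    then have "|C| =o r" using assms(2,3) unfolding regularCard_def by blast
    then show False using assms(4) not_ordLess_ordIso by blast
  qed
  then show ?thesis using le ordLeq_iff_ordLess_or_ordIso by blast
qed

text \<open>A set too small to be cofinal has no member strictly above some \<open>\<delta>\<close>;
  by linearity this \<open>\<delta>\<close> bounds it.\<close>

lemma regularCard_bounded:
  assumes "Card_order r" "regularCard r" "X \<subseteq> Field r" "|X| <o r"
  shows "\<exists>\<delta>\<in>Field r. X \<subseteq> under r \<delta>"
proof -
  have "\<not> cofinal X r"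
    using assms unfolding regularCard_def using not_ordLess_ordIso by blast
  then obtain \<delta> where \<delta>: "\<delta> \<in> Field r" "\<forall>b\<in>X. \<delta> = b \<or> (\<delta>, b) \<notin> r"
    unfolding cofinal_def by blast
  have "(b, \<delta>) \<in> r" if "b \<in> X" for b
  proof -
    have wo: "wo_rel r" using assms(1) unfolding card_order_on_def wo_rel_def by blast
    have "(b, \<delta>) \<in> r \<or> (\<delta>, b) \<in> r" "(b, b) \<in> r"
      using wo_rel.TOTALS[OF wo] assms(3) \<delta>(1) that by blast+
    then show ?thesis using \<delta>(2) that by metis
  qed
  then show ?thesis using \<delta>(1) unfolding under_def by blast
qed

section \<open>The partition relation from the stick principle\<close>

theorem theorem4p3:
  fixes lam :: "'a rel" and \<theta> :: "'b rel"
  assumes "Card_order lam" and "cinfinite lam"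
    and "Card_order \<theta>" and "\<theta> =o cofinality lam" and "\<theta> <o lam"
    and "stick lam"
  shows "negative_partition (cardSuc lam) (cardSuc lam) 3 \<theta>"
proof -
  let ?mu = "cardSuc lam"
  have infl: "infinite (Field lam)" using assms(2) unfolding cinfinite_def .
  have mu: "Card_order ?mu" "infinite (Field ?mu)" "regularCard ?mu"
    using assms(1) infl cardSuc_Card_order cardSuc_finite infinite_cardSuc_regularCard by blast+
  have wo: "wo_rel ?mu" using mu(1) unfolding card_order_on_def wo_rel_def by blast
  have small: "|X| <o ?mu \<longleftrightarrow> |X| \<le>o lam" for X :: "'z set"
    using cardSuc_ordLeq_ordLess[OF assms(1) card_of_Card_order] .
  \<comment> \<open>Needed for every \<open>\<alpha>\<close> of the type, since the recursion is not
    confined to the field.\<close>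
  have underS_mu: "|underS ?mu \<alpha>| \<le>o lam" for \<alpha>
  proof (cases "\<alpha> \<in> Field ?mu")
    case True
    then show ?thesis using card_of_underS[OF mu(1)] small by blast
  next
    case False
    then have "underS ?mu \<alpha> = {}" by (rule underS_empty)
    then show ?thesis using assms(1) by (simp add: card_of_empty1)
  qed

  obtain C where C: "C \<subseteq> Field lam" "cofinal C lam" and \<theta>C: "\<theta> =o |C|"
    using someI_ex[OF least_cofinal_exists[OF assms(1,2)]] assms(4)
    unfolding cofinality_def least_cofinal_def by blast
  have infC: "infinite C" using cofinal_infinite[OF assms(1) infl C] .
  have F\<theta>: "|Field \<theta>| =o \<theta>" using assms(3) by (rule card_of_Field_ordIso)
  have inf\<theta>: "infinite (Field \<theta>)"
    using infC F\<theta> \<theta>C card_of_ordIso_finite ordIso_transitive by metis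
  define z where "z = least_elem \<theta>"
  define J where "J = Field \<theta> - {z}"
  have wo\<theta>: "wo_rel \<theta>" using assms(3) unfolding card_order_on_def wo_rel_def by blast
  have zF: "z \<in> Field \<theta>"
    using wo_rel.minim_in[OF wo\<theta>, of "Field \<theta>"] inf\<theta> unfolding z_def least_elem_def by force
  have "|J| =o |Field \<theta>|"
  proof -
    have "|J \<union> {z}| <o |Field \<theta>|" if "|J| <o |Field \<theta>|"
      using card_of_Un_ordLess_infinite[OF inf\<theta> that] finite_ordLess_infinite[OF card_of_Well_order card_of_Well_order] inf\<theta>
      by (metis Field_card_of finite.emptyI finite_insert)
    moreover have "Field \<theta> \<subseteq> J \<union> {z}" "J \<subseteq> Field \<theta>"
      unfolding J_def by blast+
    ultimately show ?thesis
      using card_of_mono1 not_ordLess_ordLeq ordLeq_iff_ordLess_or_ordIso by metis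
  qed
  then have "|J| =o |C|" using F\<theta> \<theta>C ordIso_transitive by blast
  then obtain h where h: "bij_betw h J C" using card_of_ordIso by blast
  \<comment> \<open>The segments below the points of \<open>C\<close> supply the sizes. Adding
    \<open>Field \<theta>\<close> makes each size infinite and keeps it below \<open>lam\<close>,
    because \<open>\<theta> <o lam\<close>.\<close>
  define k where "k i = |underS lam (h i) <+> Field \<theta>|" for i
  have Cless: "|C| <o lam" using \<theta>C assms(5) ordIso_symmetric ordIso_ordLess_trans by blast
  have hJ: "h i \<in> Field lam" if "i \<in> J" for i
    using h C(1) that unfolding bij_betw_def by blast
  have k1: "Card_order (k i)" "infinite (Field (k i))" for i
    unfolding k_def using card_of_Card_order by blast (simp add: Field_card_of inf\<theta>)
  have k2: "cardSuc (k i) <o lam" if "i \<in> J" for i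
  proof (rule singular_cardSuc_ordLess[OF assms(1) C Cless k1])
    show "k i <o lam"
      unfolding k_def
    proof (rule card_of_Plus_ordLess_infinite_Field[OF infl assms(1)])
      show "|underS lam (h i)| <o lam" using card_of_underS[OF assms(1) hJ[OF that]] .
      show "|Field \<theta>| <o lam" using F\<theta> assms(5) ordIso_ordLess_trans by blast
    qed
  qed
  have L1: "|underS lam (h i)| \<le>o k i" for i
    unfolding k_def by (rule card_of_Plus1)
  have L2: "Field lam \<subseteq> (\<Union>i\<in>J. underS lam (h i))"
  proof
    fix a assume "a \<in> Field lam"
    then obtain b where "b \<in> C" "a \<noteq> b" "(a, b) \<in> lam"
      using C(2) unfolding cofinal_def by blast
    then show "a \<in> (\<Union>i\<in>J. underS lam (h i))"
      using h unfolding bij_betw_def underS_def by blast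
  qed

  obtain F where F: "stick_family lam ?mu F" "|F| =o ?mu"
    using assms(6) unfolding stick_def by blast
  have "|Field ?mu| =o |F|"
    using F(2) card_of_Field_ordIso[OF mu(1)] ordIso_symmetric ordIso_transitive by blast
  then obtain T where T: "bij_betw T (Field ?mu) F" using card_of_ordIso by blast
  have Tsub: "T \<eta> \<in> subsets_of_card (Field ?mu) lam" if "\<eta> \<in> Field ?mu" for \<eta>
    using F(1) T that unfolding stick_family_def bij_betw_def by blast
  have T1: "|T \<eta>| =o lam" if "\<eta> \<in> Field ?mu" for \<eta>
    using Tsub[OF that] unfolding subsets_of_card_def by blast
  have underS_mu': "|underS ?mu \<alpha>| \<le>o |Field lam|" for \<alpha>
    using underS_mu card_of_Field_ordIso[OF assms(1)] ordIso_symmetric ordLeq_ordIso_trans by blast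
  have zJ: "z \<notin> J" unfolding J_def by blast
  obtain f where f: "\<forall>\<alpha>. (\<forall>\<beta>. f \<alpha> \<beta> \<in> insert z J) \<and>
    (\<forall>i\<in>J. |{\<beta> \<in> underS ?mu \<alpha>. f \<alpha> \<beta> = i}| \<le>o k i \<and>
      (\<forall>\<beta> \<in> underS ?mu \<alpha>. \<forall>\<gamma> \<in> underS ?mu \<alpha>. \<gamma> \<in> underS ?mu \<beta> \<longrightarrow> f \<alpha> \<beta> = i \<longrightarrow> f \<alpha> \<gamma> = i \<longrightarrow> f \<beta> \<gamma> \<noteq> i)) \<and>
    (\<forall>\<eta> \<in> underS ?mu \<alpha>. T \<eta> \<subseteq> underS ?mu \<alpha> \<longrightarrow> (\<exists>\<beta> \<in> T \<eta>. f \<alpha> \<beta> \<noteq> z))"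
    using colouring_exists[where k = k and L = "\<lambda>i. underS lam (h i)" and lam = lam and T = T
      and J = J and z = z, OF mu(1) underS_mu' k1 k2 L1 L2 T1 zJ]
    by blast
  have f1: "f \<alpha> \<beta> \<in> insert z J" for \<alpha> \<beta>
    using f by blast
  have f2: "f \<beta> \<gamma> \<noteq> i"
    if "i \<in> J" "\<beta> \<in> underS ?mu \<alpha>" "\<gamma> \<in> underS ?mu \<alpha>" "\<gamma> \<in> underS ?mu \<beta>" "f \<alpha> \<beta> = i" "f \<alpha> \<gamma> = i"
    for \<alpha> \<beta> \<gamma> i
    using f that by blast
  have f3: "\<exists>\<beta> \<in> T \<eta>. f \<alpha> \<beta> \<noteq> z" if "\<eta> \<in> underS ?mu \<alpha>" "T \<eta> \<subseteq> underS ?mu \<alpha>" for \<alpha> \<eta>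
    using f that by blast

  \<comment> \<open>The pair is read with its larger element first; antisymmetry makes this reading
    unique, so \<open>SOME\<close> has only one candidate.\<close>
  define c where "c X = (SOME i. \<exists>\<alpha> \<beta>. X = {\<alpha>, \<beta>} \<and> \<beta> \<in> underS ?mu \<alpha> \<and> i = f \<alpha> \<beta>)" for X
  have anti: "\<not> (\<beta> \<in> underS ?mu \<alpha> \<and> \<alpha> \<in> underS ?mu \<beta>)" for \<alpha> \<beta>
    using wo_rel.ANTISYM[OF wo] unfolding underS_def antisym_def by blast
  have c: "c {\<alpha>, \<beta>} = f \<alpha> \<beta>" if "\<beta> \<in> underS ?mu \<alpha>" for \<alpha> \<beta>
    unfolding c_def
  proof (rule some_equality)
    show "\<exists>\<alpha>' \<beta>'. {\<alpha>, \<beta>} = {\<alpha>', \<beta>'} \<and> \<beta>' \<in> underS ?mu \<alpha>' \<and> f \<alpha> \<beta> = f \<alpha>' \<beta>'"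
      using that by blast
    fix i assume "\<exists>\<alpha>' \<beta>'. {\<alpha>, \<beta>} = {\<alpha>', \<beta>'} \<and> \<beta>' \<in> underS ?mu \<alpha>' \<and> i = f \<alpha>' \<beta>'"
    then show "i = f \<alpha> \<beta>" using that anti by (auto simp: doubleton_eq_iff)
  qed
  have c_in: "c \<in> nsets (Field ?mu) 2 \<rightarrow> Field \<theta>"
  proof
    fix X assume "X \<in> nsets (Field ?mu) 2"
    then obtain \<alpha> \<beta> where "X = {\<alpha>, \<beta>}" "\<alpha> \<in> Field ?mu" "\<beta> \<in> Field ?mu" "\<alpha> \<noteq> \<beta>"
      by (rule nsets2_E)
    then obtain \<alpha> \<beta> where "X = {\<alpha>, \<beta>}" "\<beta> \<in> underS ?mu \<alpha>"
      using underS_trichotomy[OF mu(1)] by (metis doubleton_eq_iff)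
    then have "c X = f \<alpha> \<beta>" using c by blast
    then show "c X \<in> Field \<theta>" using f1[of \<alpha> \<beta>] zF unfolding J_def by auto
  qed
  have no_large: "c ` nsets A 2 \<noteq> {z}" if A: "A \<in> subsets_of_card (Field ?mu) ?mu" for A
  proof
    assume hom: "c ` nsets A 2 = {z}"
    obtain x where x: "x \<in> F" "x \<subseteq> A" using F(1) A unfolding stick_family_def by blast
    then obtain \<eta> where \<eta>: "\<eta> \<in> Field ?mu" "x = T \<eta>" using T unfolding bij_betw_def by blast
    have AF: "A \<subseteq> Field ?mu" "|A| =o ?mu" using A unfolding subsets_of_card_def by blast+
    \<comment> \<open>The index is included because \<open>f3\<close> needs both
      \<open>\<eta>\<close> and all of \<open>T \<eta>\<close> to lie below
      \<open>\<alpha>\<close>.\<close>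
    have "|insert \<eta> (T \<eta>)| \<le>o lam"
    proof -
      have "|T \<eta>| \<le>o lam" using T1[OF \<eta>(1)] by (rule ordIso_imp_ordLeq)
      moreover have "|{\<eta>}| <o lam"
        by (rule finite_ordLess_infinite[OF card_of_Well_order
            card_order_on_well_order_on[OF assms(1)] _ infl]) (simp add: Field_card_of)
      then have "|{\<eta>}| \<le>o lam" by (rule ordLess_imp_ordLeq)
      ultimately have "|{\<eta>} \<union> T \<eta>| \<le>o lam"
        using card_of_Un_ordLeq_infinite_Field[OF infl _ _ assms(1)] by blast
      then show ?thesis by simp
    qed
    then obtain \<delta> where \<delta>: "\<delta> \<in> Field ?mu" "insert \<eta> (T \<eta>) \<subseteq> under ?mu \<delta>"
      using regularCard_bounded[OF mu(1,3), of "insert \<eta> (T \<eta>)"] \<eta> x(2) AF(1) small by blast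
    have "|under ?mu \<delta>| <o |A|"
    proof -
      \<comment> \<open>\<open>underS_mu\<close> concerns strict segments, so the closed segment up
        to \<open>\<delta>\<close> is placed inside the strict one of a larger
        \<open>\<epsilon>\<close>.\<close>
      obtain \<epsilon> where "\<delta> \<noteq> \<epsilon>" "(\<delta>, \<epsilon>) \<in> ?mu"
        using infinite_Card_order_limit[OF mu(1,2) \<delta>(1)] by blast
      have "under ?mu \<delta> \<subseteq> underS ?mu \<epsilon>"
        using wo_rel.ANTISYM[OF wo] wo_rel.TRANS[OF wo] \<open>\<delta> \<noteq> \<epsilon>\<close> \<open>(\<delta>, \<epsilon>) \<in> ?mu\<close>
        unfolding under_def underS_def antisym_def trans_def by blast
      then have "|under ?mu \<delta>| \<le>o lam"
        using card_of_mono1 underS_mu ordLeq_transitive by blast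
      then show ?thesis using small AF(2) ordIso_symmetric ordLess_ordIso_trans by blast
    qed
    then obtain \<alpha> where \<alpha>: "\<alpha> \<in> A" "\<alpha> \<notin> under ?mu \<delta>" by (rule card_of_ordLess_not_subset)
    have below: "\<beta> \<in> underS ?mu \<alpha>" if \<beta>: "\<beta> \<in> under ?mu \<delta>" for \<beta>
    proof -
      have "\<alpha> \<noteq> \<beta>" using \<beta> \<alpha>(2) by blast
      moreover have "\<beta> \<in> Field ?mu" using \<beta> unfolding under_def by (auto intro: FieldI1)
      moreover have "\<alpha> \<notin> underS ?mu \<beta>"
        using \<alpha>(2) \<beta> wo_rel.TRANS[OF wo] unfolding under_def underS_def trans_def by blast
      ultimately show ?thesis using underS_trichotomy[OF mu(1)] \<alpha>(1) AF(1) by blast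
    qed
    then obtain \<beta> where \<beta>: "\<beta> \<in> T \<eta>" "f \<alpha> \<beta> \<noteq> z" using f3[of \<eta> \<alpha>] \<delta>(2) by blast
    then have "\<beta> \<in> underS ?mu \<alpha>" using below \<delta>(2) by blast
    moreover from this have "{\<alpha>, \<beta>} \<in> nsets A 2"
      using \<alpha>(1) \<beta>(1) x(2) \<eta>(2) unfolding underS_def by auto
    then have "c {\<alpha>, \<beta>} \<in> c ` nsets A 2" by (rule imageI)
    then have "c {\<alpha>, \<beta>} = z" unfolding hom by simp
    ultimately show False using c \<beta>(2) by metis
  qed
  have no_triple: "c ` nsets B 2 \<noteq> {i}"
    if B: "B \<in> nsets (Field ?mu) 3" and i: "i \<in> J" for B i
  proof
    assume hom: "c ` nsets B 2 = {i}"
    have *: "f \<alpha> \<beta> = i" if "\<alpha> \<in> B" "\<beta> \<in> B" "\<beta> \<in> underS ?mu \<alpha>" for \<alpha> \<beta>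
    proof -
      have "{\<alpha>, \<beta>} \<in> nsets B 2" using that unfolding underS_def by auto
      then have "c {\<alpha>, \<beta>} \<in> c ` nsets B 2" by (rule imageI)
      then show ?thesis using hom c[OF that(3)] by simp
    qed
    have no: False if "\<alpha> \<in> B" "\<beta> \<in> B" "\<gamma> \<in> B" "\<beta> \<in> underS ?mu \<alpha>" "\<gamma> \<in> underS ?mu \<beta>" for \<alpha> \<beta> \<gamma>
    proof -
      have "\<gamma> \<in> underS ?mu \<alpha>"
        using that(4,5) wo_rel.TRANS[OF wo] wo_rel.ANTISYM[OF wo]
        unfolding underS_def trans_def antisym_def by blast
      then show False using f2[OF i that(4) _ that(5)] * that by blast
    qed
    obtain u v w where uvw: "u \<in> B" "v \<in> B" "w \<in> B" "u \<noteq> v" "u \<noteq> w" "v \<noteq> w"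
      and sub: "B \<subseteq> Field ?mu"
      using B unfolding nsets_3_eq by blast
    \<comment> \<open>However the three comparisons fall out, even cyclically, two of them chain
      into a descending triple to which \<open>no\<close> applies.\<close>
    have "u \<in> underS ?mu v \<or> v \<in> underS ?mu u" "u \<in> underS ?mu w \<or> w \<in> underS ?mu u"
      "v \<in> underS ?mu w \<or> w \<in> underS ?mu v"
      using underS_trichotomy[OF mu(1)] uvw sub by blast+
    then show False using no uvw by blast
  qed
  show ?thesis
    unfolding negative_partition_def
    using c_in no_large no_triple unfolding z_def J_def by blast
qed

end
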